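(* Consider an instance of the capacitated vehicle routing problem (CVRP) with customers $\mathscr{c}_1,\dots,\mathscr{c}_N$ in the Euclidean plane $\mathcal{X}=\mathbb{R}^2$. Suppose there exists a centroids combination $\Omega=\{\mu_1,\mu_2,\ldots,\mu_K\}$, $\mu_k\in\mathcal{X}$, that yields an optimal CVRP solution, with associated clusters $S_1,\dots,S_K$, and suppose that $\Omega$ includes a strict centroid $\mu_{k^{\ast}}$ (with respect to these clusters). Then there exist infinitely many centroids combinations (of $K$ points of $\mathcal{X}$) that also yield an optimal solution of the CVRP.
   Context: CVRP. There is a depot (index $0$) and a finite set $\mathcal{C}=\{\mathscr{c}_1,\dots,\mathscr{c}_N\}$ of customers, each given by its coordinates $\mathscr{c}_i=(\mathscr{x}_i,\mathscr{y}_i)\in\mathcal{X}=\mathbb{R}^2$. Customer $i$ has demand $q_i$ (with $q_0=0$ for the depot), $d_{ij}$ is the distance between locations $i$ and $j$, and there is a homogeneous fleet of $M$ vehicles, each of capacity $Q$. A route is a sequence of locations starting and ending at the depot, visiting at least one customer, whose customers have total demand at most $Q$; its cost is the total distance traveled along it. A CVRP solution is a collection of at most $M$ routes such that every customer is visited exactly once in total; it is optimal if it minimizes the total cost among all solutions. Distance. $d(P,P')=\sqrt{(\mathscr{x}_P-\mathscr{x}_{P'})^2+(\mathscr{y}_P-\mathscr{y}_{P'})^2}$ is the Euclidean distance on $\mathcal{X}$. Centroids combination yielding an optimal solution. A centroids combination is a choice of points $\Omega=\{\mu_1,\dots,\mu_K\}$, $\mu_k\in\mathcal{X}$, one for each cluster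 index $k\in\mathcal{K}=\{1,\dots,K\}$; these points are free points of the plane, not required to be the arithmetic means of the clusters. It yields (equivalently, provides, gives, or guarantees) an optimal CVRP solution if there is an optimal CVRP solution with routes $\rho_1,\dots,\rho_K$ such that, writing $S_k=\{\mathscr{c}_i:\mathscr{c}_i\in\rho_k\}$ for the set of customers served by route $\rho_k$ (these are the clusters associated with $\Omega$, and they partition $\mathcal{C}$), every customer is at least as close to the centroid of its own cluster as to any other centroid: $$(\mathscr{x}_{\mu_k}-\mathscr{x}_j)^2+(\mathscr{y}_{\mu_k}-\mathscr{y}_j)^2\le \min_{k'\in\mathcal{K}\setminus\{k\}}\left[(\mathscr{x}_{\mu_{k'}}-\mathscr{x}_j)^2+(\mathscr{y}_{\mu_{k'}}-\mathscr{y}_j)^2\right]\qquad \forall\,\mathscr{c}_j\in S_k,\ \forall\,k\in\mathcal{K}.$$ Strict centroid. Given clusters $S_1,\dots,S_K$ with centroids $\mu_1,\dots,\mu_K$, the centroid $\mu_{k^{\ast}}$ of $S_{k^{\ast}}$ is a strict centroid if $$d(\mu_{k^{\ast}},\mathscr{c}_i)<d(\mu_k,\mathscr{c}_i)\quad\forall\,\mathscr{c}_i\in S_{k^{\ast}},\ \forall\,k\in\mathcal{K}\setminus\{k^{\ast}\},$$ $$d(\mu_{k^{\ast}},\mathscr{c}_j)>d(\mu_k,\mathscr{c}_j)\quad\forall\,\mathscr{c}_j\in S_k,\ \forall\,k\in\mathcal{K}\setminus\{k^{\ast}\}.$$ *)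

theory Defs
  imports "HOL-Analysis.Analysis"
begin

(* Location 0 is the depot; locations 1, ..., ncust are the customers. Customers are
   referred to by index, so two of them may share their coordinates. *)
record cvrp =
  ncust :: nat
  loc :: "nat \<Rightarrow> real ^ 2"
  demand :: "nat \<Rightarrow> real"
  capacity :: real
  fleet :: nat

definition cvrp_instance :: "cvrp \<Rightarrow> bool" where
  "cvrp_instance I \<longleftrightarrow> demand I 0 = 0"

definition customers :: "cvrp \<Rightarrow> nat set" where
  "customers I = {1..ncust I}"

definition served :: "cvrp \<Rightarrow> nat list \<Rightarrow> nat set" where
  "served I r = set r \<inter> customers I"

definition is_route :: "cvrp \<Rightarrow> nat list \<Rightarrow> bool" where
  "is_route I r \<longleftrightarrow>
     (\<exists>cs. cs \<noteq> [] \<and> set cs \<subseteq> customers I \<and> r = 0 # cs @ [0]) \<and>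
     (\<Sum>i\<in>served I r. demand I i) \<le> capacity I"

(* dist on real ^ 2 is the Euclidean distance. *)
definition route_cost :: "cvrp \<Rightarrow> nat list \<Rightarrow> real" where
  "route_cost I r = (\<Sum>t<length r - 1. dist (loc I (r ! t)) (loc I (r ! Suc t)))"

definition is_solution :: "cvrp \<Rightarrow> nat \<Rightarrow> (nat \<Rightarrow> nat list) \<Rightarrow> bool" where
  "is_solution I K \<rho> \<longleftrightarrow>
     K \<le> fleet I \<and>
     (\<forall>k\<in>{1..K}. is_route I (\<rho> k)) \<and>
     (\<forall>i\<in>customers I. (\<Sum>k=1..K. count_list (\<rho> k) i) = 1)"

definition solution_cost :: "cvrp \<Rightarrow> nat \<Rightarrow> (nat \<Rightarrow> nat list) \<Rightarrow> real" where
  "solution_cost I K \<rho> = (\<Sum>k=1..K. route_cost I (\<rho> k))"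

definition is_optimal :: "cvrp \<Rightarrow> nat \<Rightarrow> (nat \<Rightarrow> nat list) \<Rightarrow> bool" where
  "is_optimal I K \<rho> \<longleftrightarrow>
     is_solution I K \<rho> \<and>
     (\<forall>K' \<rho>'. is_solution I K' \<rho>' \<longrightarrow> solution_cost I K \<rho> \<le> solution_cost I K' \<rho>')"

definition cluster :: "cvrp \<Rightarrow> (nat \<Rightarrow> nat list) \<Rightarrow> nat \<Rightarrow> nat set" where
  "cluster I \<rho> k = served I (\<rho> k)"

(* Extensional functions, so that two combinations are equal exactly when their
   K points agree; otherwise values outside {1..K} would make any count infinite. *)
definition centroids_combinations :: "nat \<Rightarrow> (nat \<Rightarrow> real ^ 2) set" where
  "centroids_combinations K = {1..K} \<rightarrow>\<^sub>E UNIV"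

(* The minimum over the other centroids is expressed by a universal quantifier,
   which makes the condition vacuous when K = 1. *)
definition yields_solution :: "cvrp \<Rightarrow> nat \<Rightarrow> (nat \<Rightarrow> real ^ 2) \<Rightarrow> (nat \<Rightarrow> nat list) \<Rightarrow> bool" where
  "yields_solution I K \<mu> \<rho> \<longleftrightarrow>
     (\<forall>k\<in>{1..K}. \<forall>j\<in>cluster I \<rho> k. \<forall>k'\<in>{1..K} - {k}.
        (dist (\<mu> k) (loc I j))\<^sup>2 \<le> (dist (\<mu> k') (loc I j))\<^sup>2)"

definition yields_optimal :: "cvrp \<Rightarrow> nat \<Rightarrow> (nat \<Rightarrow> real ^ 2) \<Rightarrow> bool" where
  "yields_optimal I K \<mu> \<longleftrightarrow> (\<exists>\<rho>. is_optimal I K \<rho> \<and> yields_solution I K \<mu> \<rho>)"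

definition strict_centroid ::
  "cvrp \<Rightarrow> nat \<Rightarrow> (nat \<Rightarrow> nat set) \<Rightarrow> (nat \<Rightarrow> real ^ 2) \<Rightarrow> nat \<Rightarrow> bool" where
  "strict_centroid I K S \<mu> ks \<longleftrightarrow>
     ks \<in> {1..K} \<and>
     (\<forall>i\<in>S ks. \<forall>k\<in>{1..K} - {ks}. dist (\<mu> ks) (loc I i) < dist (\<mu> k) (loc I i)) \<and>
     (\<forall>k\<in>{1..K} - {ks}. \<forall>j\<in>S k. dist (\<mu> ks) (loc I j) > dist (\<mu> k) (loc I j))"

end

(* The strict inequalities defining a strict centroid are finitely many open conditions on its
   position, so they survive every small enough displacement of that centroid. Each displaced
   combination yields the same routes, which stay optimal because optimality does not involve
   the centroids. *)
theory Submission
  imports Defs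
begin

lemma finite_cluster: "finite (cluster I \<rho> k)"
  by (simp add: cluster_def served_def)

text \<open>Each inequality compares a continuous function of \<open>p\<close> with a constant,
  since \<open>\<mu> k\<close> is unaffected by the update when \<open>k \<noteq> ks\<close>.
  Finiteness of the clusters lets the eventual quantifier pass through the bounded ones.\<close>

lemma strict_centroid_eventually:
  assumes "strict_centroid I K S \<mu> ks" and "\<And>k. k \<in> {1..K} \<Longrightarrow> finite (S k)"
  shows "\<forall>\<^sub>F p in nhds (\<mu> ks). strict_centroid I K S (\<mu>(ks := p)) ks"
proof -
  have tends: "((\<lambda>p. dist p c) \<longlongrightarrow> dist (\<mu> ks) c) (nhds (\<mu> ks))" for c
    by (intro tendsto_intros filterlim_ident)
  have "\<forall>\<^sub>F p in nhds (\<mu> ks). \<forall>i\<in>S ks. \<forall>k\<in>{1..K} - {ks}. dist p (loc I i) < dist (\<mu> k) (loc I i)"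
    using assms
    by (auto simp: strict_centroid_def eventually_ball_finite_distrib intro!: order_tendstoD(2)[OF tends])
  moreover have "\<forall>\<^sub>F p in nhds (\<mu> ks). \<forall>k\<in>{1..K} - {ks}. \<forall>j\<in>S k. dist p (loc I j) > dist (\<mu> k) (loc I j)"
    using assms
    by (auto simp: strict_centroid_def eventually_ball_finite_distrib intro!: order_tendstoD(1)[OF tends])
  ultimately show ?thesis
    by eventually_elim (use assms(1) in \<open>auto simp: strict_centroid_def\<close>)
qed

text \<open>Moving \<open>\<mu> ks\<close> alters only the comparisons that involve
  \<open>ks\<close>, and strictness at the new position \<open>p\<close> settles those; all others
  are inherited from \<open>\<mu>\<close>.\<close>

lemma yields_solution_move_strict_centroid:
  assumes "yields_solution I K \<mu> \<rho>"
    and "strict_centroid I K (cluster I \<rho>) (\<mu>(ks := p)) ks"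
  shows "yields_solution I K (\<mu>(ks := p)) \<rho>"
  unfolding yields_solution_def
proof (intro ballI)
  fix k j k' assume *: "k \<in> {1..K}" "j \<in> cluster I \<rho> k" "k' \<in> {1..K} - {k}"
  show "(dist ((\<mu>(ks := p)) k) (loc I j))\<^sup>2 \<le> (dist ((\<mu>(ks := p)) k') (loc I j))\<^sup>2"
  proof (cases "k = ks \<or> k' = ks")
    case True
    \<comment> \<open>The first family of strict inequalities covers \<open>k = ks\<close>, the
      second \<open>k' = ks\<close>.\<close>
    then have "dist ((\<mu>(ks := p)) k) (loc I j) < dist ((\<mu>(ks := p)) k') (loc I j)"
      using * assms(2) unfolding strict_centroid_def by (metis DiffI Diff_iff singletonD singletonI)
    then show ?thesis
      by (simp add: power_mono)
  next
    case False
    then show ?thesis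
      using * assms(1) by (simp add: yields_solution_def)
  qed
qed

theorem theorem1:
  fixes I :: cvrp and K ks :: nat
    and \<mu> :: "nat \<Rightarrow> real ^ 2" and \<rho> :: "nat \<Rightarrow> nat list"
  assumes "cvrp_instance I"
    and "\<mu> \<in> centroids_combinations K"
    and "is_optimal I K \<rho>"
    and "yields_solution I K \<mu> \<rho>"
    and "strict_centroid I K (cluster I \<rho>) \<mu> ks"
  shows "infinite {\<mu>' \<in> centroids_combinations K. yields_optimal I K \<mu>'}"
proof -
  obtain U where U: "open U" "\<mu> ks \<in> U"
    and strict: "\<And>p. p \<in> U \<Longrightarrow> strict_centroid I K (cluster I \<rho>) (\<mu>(ks := p)) ks"
    using strict_centroid_eventually[OF assms(5) finite_cluster] unfolding eventually_nhds by blast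
  \<comment> \<open>The plane has no isolated points, so a nonempty open set cannot be
    finite.\<close>
  have "infinite U"
    using U finite_imp_not_open by blast
  moreover have "inj_on (\<lambda>p. \<mu>(ks := p)) U"
    by (rule inj_onI) (metis fun_upd_same)
  ultimately have "infinite ((\<lambda>p. \<mu>(ks := p)) ` U)"
    by (simp add: finite_image_iff)
  \<comment> \<open>The update stays extensional because a strict centroid has its index
    \<open>ks\<close> in \<open>{1..K}\<close>.\<close>
  moreover have "\<mu>(ks := p) \<in> centroids_combinations K" for p
    using assms(2,5) by (auto simp: centroids_combinations_def strict_centroid_def PiE_iff extensional_def)
  then have "(\<lambda>p. \<mu>(ks := p)) ` U \<subseteq> {\<mu>' \<in> centroids_combinations K. yields_optimal I K \<mu>'}"
    using strict yields_solution_move_strict_centroid[OF assms(4)] assms(3)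
    by (auto simp: yields_optimal_def)
  ultimately show ?thesis
    using finite_subset by blast
qed

end
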